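(* Let $\tau^{\mathrm{ss}}_i$ be a self-suspending task allocated to core $p_k$, with relative deadline $D_i$, and let $hp_k(\tau^{\mathrm{ss}}_i)$ be the set of self-suspending tasks allocated to $p_k$ with priority higher than that of $\tau^{\mathrm{ss}}_i$. Assume that $\tau^{\mathrm{ss}}_i$ and all tasks in $hp_k(\tau^{\mathrm{ss}}_i)$ are released according to the release pattern $\Lambda$ defined in the context. Let $\tau^{\mathrm{ss}}_h \in hp_k(\tau^{\mathrm{ss}}_i)$ have period $T_h$ and maximum release jitter $J_h$. If $T_h - J_h < D_i$, then $\tau^{\mathrm{ss}}_h$ has more than one activation in $[0, D_i]$, and its last activation in the interval $[0,D_i]$ occurs at time $$V_{i,h} = \left\lfloor \frac{D_i + J_h}{T_h} \right\rfloor \cdot T_h - J_h .$$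
   Context: Self-suspending tasks. A (segmented) self-suspending task $\tau^{\mathrm{ss}}_h$ consists of an ordered sequence of alternating execution regions (with worst-case execution times $C_{h,1}, C_{h,2},\dots$) and suspension regions (with durations bounded by $S_{h,1}, S_{h,2},\dots$); it may also have no suspension region. It is released periodically with period $T_h$ (producing an infinite sequence of instances), has relative deadline $D_h \le T_h$ and a unique fixed priority. Tasks are statically allocated to cores and scheduled on each core by preemptive fixed-priority scheduling. Let $C_h = \sum_j C_{h,j}$ and $S_h = \sum_j S_{h,j}$. Release jitter. In the jitter-based analysis, the effect of the suspensions of an interfering (higher-priority) task $\tau^{\mathrm{ss}}_h$ is modeled as a release jitter bounded by a value $J_h \ge 0$. If $\tau^{\mathrm{ss}}_h$ has no suspension region then $J_h = 0$; otherwise a valid bound is $J_h = R_h - C_h$, where $R_h$ is an upper bound on the worst-case response time of $\tau^{\mathrm{ss}}_h$ (or, when $R_h \le D_h$, $J_h = D_h - C_h$). An instance of $\tau^{\mathrm{ss}}_h$ nominally released at time $r$ and experiencing jitter $j$ becomes ready to execute (is activated) at time $r + j$. Release pattern $\Lambda$ (with respect to the task under analysis $\tau^{\mathrm{ss}}_i$): (i) $\tau^{\mathrm{ss}}_i$ is released at time $t=0$ with no jitter and experiences a worst-case suspension of $S_i$ time units; (ii) every higher-priority task $\tau^{\mathrm{ss}}_h \in hp_k(\tau^{\mathrm{ss}}_i)$ is ready to execute at $t=0$ after experiencing maximum jitter, i.e., its first periodic instance is nominally released at time $-J_h$ and is activated at time $0$; (iii) all successive instances are released periodically (with period $T_h$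 from the nominal release $-J_h$) with zero jitter.
   Formalization: The formal theorem additionally assumes J_h ≤ T_h; without it the claim fails, e.g. T_h = 10, J_h = 18, D_i = 1 gives only one activation in [0,1] while the formula gives −8. *)

theory Defs
  imports Complex_Main
begin

(* Time is real-valued. A larger priority value means a higher priority. *)

record ('core, 'prio) ss_task =
  exec_regions :: "real list"
  susp_regions :: "real list"
  period :: real
  deadline :: real
  priority :: 'prio
  core :: 'core

definition wcet :: "('core, 'prio) ss_task \<Rightarrow> real" where
  "wcet \<tau> = sum_list (exec_regions \<tau>)"

definition max_susp :: "('core, 'prio) ss_task \<Rightarrow> real" where
  "max_susp \<tau> = sum_list (susp_regions \<tau>)"

(* Regions alternate, starting and ending with an execution region. *)
definition wf_ss_task :: "('core, 'prio) ss_task \<Rightarrow> bool" where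
  "wf_ss_task \<tau> \<longleftrightarrow>
     length (exec_regions \<tau>) = Suc (length (susp_regions \<tau>)) \<and>
     (\<forall>c\<in>set (exec_regions \<tau>). 0 \<le> c) \<and>
     (\<forall>s\<in>set (susp_regions \<tau>). 0 \<le> s) \<and>
     0 < deadline \<tau> \<and> deadline \<tau> \<le> period \<tau>"

definition task_system :: "('core, 'prio::linorder) ss_task set \<Rightarrow> bool" where
  "task_system \<Gamma> \<longleftrightarrow> (\<forall>\<tau>\<in>\<Gamma>. wf_ss_task \<tau>) \<and> inj_on priority \<Gamma>"

definition hp ::
  "('core, 'prio::linorder) ss_task set \<Rightarrow> 'core \<Rightarrow> ('core, 'prio) ss_task \<Rightarrow> ('core, 'prio) ss_task set" where
  "hp \<Gamma> k \<tau> = {\<tau>' \<in> \<Gamma>. core \<tau>' = k \<and> priority \<tau> < priority \<tau>'}"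

(* J is an arbitrary admissible bound on the release jitter that stands for the suspensions
   of an interfering task. With R a response-time bound, the usual choices R - wcet and
   deadline - wcet for a suspending task are particular values of J; both are at most the
   period whenever R \<le> deadline. *)
definition jitter_bound :: "('core, 'prio) ss_task \<Rightarrow> real \<Rightarrow> bool" where
  "jitter_bound \<tau> J \<longleftrightarrow> 0 \<le> J \<and> (susp_regions \<tau> = [] \<longrightarrow> J = 0)"

(* For every task and every instance number (counted from 0): the nominal release time,
   the release jitter, and the total time for which the instance suspends itself. *)
record ('core, 'prio) release_behaviour =
  nominal_release :: "('core, 'prio) ss_task \<Rightarrow> nat \<Rightarrow> real"
  jitter :: "('core, 'prio) ss_task \<Rightarrow> nat \<Rightarrow> real"
  suspension :: "('core, 'prio) ss_task \<Rightarrow> nat \<Rightarrow> real"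

definition activation ::
  "('core, 'prio) release_behaviour \<Rightarrow> ('core, 'prio) ss_task \<Rightarrow> nat \<Rightarrow> real" where
  "activation b \<tau> n = nominal_release b \<tau> n + jitter b \<tau> n"

definition release_pattern_Lambda ::
  "('core, 'prio) ss_task \<Rightarrow> ('core, 'prio) ss_task set \<Rightarrow> (('core, 'prio) ss_task \<Rightarrow> real) \<Rightarrow>
   ('core, 'prio) release_behaviour \<Rightarrow> bool" where
  "release_pattern_Lambda \<tau>i H J b \<longleftrightarrow>
     nominal_release b \<tau>i 0 = 0 \<and> jitter b \<tau>i 0 = 0 \<and> suspension b \<tau>i 0 = max_susp \<tau>i \<and>
     (\<forall>\<tau>\<in>H. nominal_release b \<tau> 0 = - J \<tau> \<and> jitter b \<tau> 0 = J \<tau>) \<and>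
     (\<forall>\<tau>\<in>insert \<tau>i H. \<forall>n.
        nominal_release b \<tau> (Suc n) = nominal_release b \<tau> n + period \<tau> \<and>
        jitter b \<tau> (Suc n) = 0)"

(* Activations are identified by instance number, so two instances that become ready at the
   same time count as two activations. *)
definition activations_in ::
  "('core, 'prio) release_behaviour \<Rightarrow> ('core, 'prio) ss_task \<Rightarrow> real set \<Rightarrow> nat set" where
  "activations_in b \<tau> I = {n. activation b \<tau> n \<in> I}"

(* Meaningful only if finitely many, and at least one, activations fall into I. *)
definition last_activation_in ::
  "('core, 'prio) release_behaviour \<Rightarrow> ('core, 'prio) ss_task \<Rightarrow> real set \<Rightarrow> real" where
  "last_activation_in b \<tau> I = Max (activation b \<tau> ` activations_in b \<tau> I)"

end

theory Submission
  imports Defs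
begin

text \<open>Under \<Lambda>, instance 0 is activated at 0 and every instance n > 0 at n * T - J.
  Since J \<le> T, these times are nonnegative and nondecreasing in n, and n * T - J \<le> D means n
  \<le> (D + J) / T. So the instances activated in [0, D] are exactly 0, ..., N with N the floor of
  (D + J) / T (\<open>activations_in_Lambda\<close>), and by \<open>mono_activation_Lambda\<close>
  the last activation is that of instance N. The condition T - J < D forces N \<ge> 1: there are at
  least two activations, and the formula for n > 0 applies to N.\<close>

lemma nominal_release_Lambda:
  assumes "release_pattern_Lambda \<tau>i H J b" and "\<tau> \<in> H"
  shows "nominal_release b \<tau> n = real n * period \<tau> - J \<tau>"
  using assms by (induction n) (auto simp: release_pattern_Lambda_def algebra_simps)

text \<open>Instance 0 is exceptional: its jitter J cancels the nominal offset -J, while all later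
  instances have zero jitter and keep the offset.\<close>

lemma activation_Lambda:
  assumes "release_pattern_Lambda \<tau>i H J b" and "\<tau> \<in> H"
  shows "activation b \<tau> n = (if n = 0 then 0 else real n * period \<tau> - J \<tau>)"
  using assms nominal_release_Lambda[OF assms]
  by (cases n) (auto simp: activation_def release_pattern_Lambda_def)

lemma activations_in_Lambda:
  assumes "release_pattern_Lambda \<tau>i H J b" and "\<tau> \<in> H"
    and "0 < period \<tau>" and "0 \<le> J \<tau>" and "J \<tau> \<le> period \<tau>" and "0 \<le> D"
  shows "activations_in b \<tau> {0..D} = {..nat \<lfloor>(D + J \<tau>) / period \<tau>\<rfloor>}"
proof -
  have "activation b \<tau> n \<in> {0..D} \<longleftrightarrow> n \<le> nat \<lfloor>(D + J \<tau>) / period \<tau>\<rfloor>" for n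
  proof (cases "n = 0")
    case True
    then show ?thesis
      using assms by (simp add: activation_Lambda)
  next
    case False
    \<comment> \<open>This gives the lower end of the interval: from n \<ge> 1 and J \<le> T, the
      activation is not before 0.\<close>
    then have "J \<tau> \<le> real n * period \<tau>"
      using assms(3,5) mult_right_mono[of 1 "real n" "period \<tau>"] by linarith
    then have "activation b \<tau> n \<in> {0..D} \<longleftrightarrow> real n \<le> (D + J \<tau>) / period \<tau>"
      using assms False by (auto simp: activation_Lambda pos_le_divide_eq)
    \<comment> \<open>As n \<ge> 1, truncation of negative values by \<open>nat\<close> cannot
      affect either side.\<close>
    also have "\<dots> \<longleftrightarrow> n \<le> nat \<lfloor>(D + J \<tau>) / period \<tau>\<rfloor>"
      using False by linarith
    finally show ?thesis .
  qed
  then show ?thesis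
    by (auto simp: activations_in_def)
qed

text \<open>The gap between consecutive activations is T - J \<ge> 0 after instance 0 and T > 0 from
  then on.\<close>

lemma mono_activation_Lambda:
  assumes "release_pattern_Lambda \<tau>i H J b" and "\<tau> \<in> H"
    and "0 < period \<tau>" and "J \<tau> \<le> period \<tau>"
  shows "mono (activation b \<tau>)"
proof (rule incseq_SucI)
  show "activation b \<tau> n \<le> activation b \<tau> (Suc n)" for n
    using assms by (simp add: activation_Lambda algebra_simps)
qed

theorem theorem1:
  fixes \<Gamma> :: "('core, 'prio::linorder) ss_task set"
    and \<tau>i \<tau>h :: "('core, 'prio) ss_task"
    and k :: 'core
    and J :: "('core, 'prio) ss_task \<Rightarrow> real"
    and b :: "('core, 'prio) release_behaviour"
  assumes "task_system \<Gamma>"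
    and "\<tau>i \<in> \<Gamma>" and "core \<tau>i = k"
    and "\<forall>\<tau>\<in>hp \<Gamma> k \<tau>i. jitter_bound \<tau> (J \<tau>)"
    and "release_pattern_Lambda \<tau>i (hp \<Gamma> k \<tau>i) J b"
    and "\<tau>h \<in> hp \<Gamma> k \<tau>i"
    and "J \<tau>h \<le> period \<tau>h"
    and "period \<tau>h - J \<tau>h < deadline \<tau>i"
  shows "finite (activations_in b \<tau>h {0..deadline \<tau>i}) \<and>
         1 < card (activations_in b \<tau>h {0..deadline \<tau>i}) \<and>
         last_activation_in b \<tau>h {0..deadline \<tau>i} =
           of_int \<lfloor>(deadline \<tau>i + J \<tau>h) / period \<tau>h\<rfloor> * period \<tau>h - J \<tau>h"
proof -
  define N where "N = nat \<lfloor>(deadline \<tau>i + J \<tau>h) / period \<tau>h\<rfloor>"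
  have wf: "wf_ss_task \<tau>i" "wf_ss_task \<tau>h"
    using assms(1,2,6) by (auto simp: task_system_def hp_def)
  then have D: "0 < deadline \<tau>i" and T: "0 < period \<tau>h"
    by (auto simp: wf_ss_task_def)
  have J: "0 \<le> J \<tau>h"
    using assms(4,6) by (auto simp: jitter_bound_def)
  have acts: "activations_in b \<tau>h {0..deadline \<tau>i} = {..N}"
    unfolding N_def using assms(5-7) T J D by (intro activations_in_Lambda) auto
  \<comment> \<open>T - J < D rearranges to T < D + J, so the quotient exceeds 1.\<close>
  have floor_ge: "1 \<le> \<lfloor>(deadline \<tau>i + J \<tau>h) / period \<tau>h\<rfloor>"
    using T assms(8) by (simp add: le_floor_iff pos_le_divide_eq)
  then have "0 < N"
    by (simp add: N_def)
  have "Max (activation b \<tau>h ` {..N}) = activation b \<tau>h N"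
    using monoD[OF mono_activation_Lambda[OF assms(5,6) T assms(7)]] by (intro Max_eqI) auto
  \<comment> \<open>N > 0 selects the periodic branch of the activation time, and
    \<open>floor_ge\<close> makes the conversion through \<open>nat\<close> lossless.\<close>
  also have "\<dots> = of_int \<lfloor>(deadline \<tau>i + J \<tau>h) / period \<tau>h\<rfloor> * period \<tau>h - J \<tau>h"
    using \<open>0 < N\<close> floor_ge by (simp add: activation_Lambda[OF assms(5,6)] N_def)
  finally show ?thesis
    using \<open>0 < N\<close> by (simp add: acts last_activation_in_def)
qed

end
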